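(* Let $T\in\mathbb{R}^{C\times C}$ be an invertible, column-stochastic matrix. Define $\underline{\theta}_T:[0,\infty]\to[0,\infty]$ by $\underline{\theta}_T(\epsilon)=\frac12\,\frac{\epsilon^2}{\|T^{-1}\|_1^2}$. Let $L$ be the $0$-$1$ loss and $\ell$ the log loss $\ell(q,c)=-\log q_c$. Then for all $f\in\mathcal{F}$ and all probability measures $P$ on $\mathcal{X}\times\mathcal{Y}$, $$\mathcal{R}_{L,P}(f)-\mathcal{R}^*_{L,P}\;\le\;\underline{\theta}_T^{-1}\left(\mathcal{R}_{\ell_T,P_T}(f)-\mathcal{R}^*_{\ell_T,P_T}\right)=\sqrt2\,\|T^{-1}\|_1\sqrt{\mathcal{R}_{\ell_T,P_T}(f)-\mathcal{R}^*_{\ell_T,P_T}}.$$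
   Context: $\mathcal{X}$ is a (measurable) feature space, $\mathcal{Y}=\{1,\dots,C\}$, $\Delta^C=\{p\in\mathbb{R}^C: p_i\ge 0\ \forall i,\ \sum_i p_i=1\}$. $\mathcal{F}$ is the set of all measurable functions $\mathcal{X}\to\Delta^C$. For a probability measure $P$ on $\mathcal{X}\times\mathcal{Y}$ (law of $(X,Y)$), a regular conditional distribution $P(\cdot\mid x)$ of $Y$ given $X=x$ is assumed to exist and is fixed; $\eta(x)=(P(1\mid x),\dots,P(C\mid x))^{tr}$. Noisy distribution: for a column-stochastic $T=(t_{i,j})$, $P_T$ is the law of $(X,\tilde Y)$ on $\mathcal{X}\times\mathcal{Y}$, where $(X,Y,\tilde Y)$ has law $\bar P_T$ with $\bar P_T(\mathcal{A}\times\{i\}\times\{j\})=P(\mathcal{A}\times\{i\})\,t_{j,i}$; the conditional distribution of $\tilde Y$ given $X=x$ under $P_T$ is $T\eta(x)$. For a loss $L$ on $\Delta^C\times\mathcal{Y}$: risk $\mathcal{R}_{L,P}(f)=\mathbb{E}_P[L(f(X),Y)]$ and Bayes risk $\mathcal{R}^*_{L,P}=\inf_{f\in\mathcal{F}}\mathcal{R}_{L,P}(f)$. The $0$-$1$ loss is $L(q,c)=\mathbf{1}_{c\neq\min\{\arg\max_j q_j\}}$. The forward correction loss of $\ell$ is $\ell_T(q,c)=\ell(Tq,c)$. Convention: $-\log 0=+\infty$ (so risks may equal $+\infty$). $\|M\|_1=\max_{1\le j\le C}\sum_{i=1}^C|M(i,j)|$ is the matrix norm induced by the vector $1$-norm.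 *)

theory Defs
  imports "HOL-Probability.Probability"
begin

(* The label set {1,...,C} is a finite linearly ordered type 'n with C = CARD('n); such a type
   is order-isomorphic to {1,...,C}, and there is one for every C >= 1.
   The feature space is a measurable space given by M :: 'a measure;
   only space M and sets M are used. *)

definition column_stochastic :: "real ^ 'n ^ 'n \<Rightarrow> bool" where
  "column_stochastic T \<longleftrightarrow> (\<forall>i j. 0 \<le> T $ i $ j) \<and> (\<forall>j. (\<Sum>i\<in>UNIV. T $ i $ j) = 1)"

definition prob_simplex :: "(real ^ 'n) set" where
  "prob_simplex = {p. (\<forall>i. 0 \<le> p $ i) \<and> (\<Sum>i\<in>UNIV. p $ i) = 1}"

definition predictors :: "'a measure \<Rightarrow> ('a \<Rightarrow> real ^ 'n) set" where
  "predictors M = M \<rightarrow>\<^sub>M restrict_space borel prob_simplex"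

definition feature_label_space :: "'a measure \<Rightarrow> ('a \<times> 'n) measure" where
  "feature_label_space M = M \<Otimes>\<^sub>M count_space UNIV"

definition prob_measure_on :: "'b measure \<Rightarrow> 'b measure \<Rightarrow> bool" where
  "prob_measure_on S P \<longleftrightarrow> prob_space P \<and> sets P = sets S"

(* The law of (X, Y, Y') with Y' the noisy label; it is characterised by
   noisy_joint_rectangle below. *)
definition noisy_joint :: "('a \<times> 'n) measure \<Rightarrow> real ^ 'n ^ 'n \<Rightarrow> (('a \<times> 'n) \<times> 'n) measure" where
  "noisy_joint P T = density (P \<Otimes>\<^sub>M count_space UNIV) (\<lambda>((x, i), j). ennreal (T $ j $ i))"

definition noisy :: "'a measure \<Rightarrow> ('a \<times> 'n) measure \<Rightarrow> real ^ 'n ^ 'n \<Rightarrow> ('a \<times> 'n) measure" where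
  "noisy M P T = distr (noisy_joint P T) (feature_label_space M) (\<lambda>((x, i), j). (x, j))"

(* A loss on the simplex; both losses below are nonnegative there and may be infinite. *)
type_synonym 'n loss = "real ^ 'n \<Rightarrow> 'n \<Rightarrow> ennreal"

definition zero_one_loss :: "'n::{finite,linorder} loss" where
  "zero_one_loss q c = of_bool (c \<noteq> Min {j. is_arg_max (\<lambda>j. q $ j) (\<lambda>_. True) j})"

(* For q in the simplex, q $ c is in [0,1], so - ln (q $ c) >= 0 unless q $ c = 0. *)
definition log_loss :: "'n::finite loss" where
  "log_loss q c = (if q $ c = 0 then \<infinity> else ennreal (- ln (q $ c)))"

definition forward_loss :: "real ^ 'n ^ 'n \<Rightarrow> 'n loss \<Rightarrow> 'n loss" where
  "forward_loss T l q c = l (T *v q) c"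

definition risk :: "'n loss \<Rightarrow> ('a \<times> 'n) measure \<Rightarrow> ('a \<Rightarrow> real ^ 'n) \<Rightarrow> ennreal" where
  "risk L P f = (\<integral>\<^sup>+ (x, y). L (f x) y \<partial>P)"

definition bayes_risk :: "'a measure \<Rightarrow> 'n::finite loss \<Rightarrow> ('a \<times> 'n) measure \<Rightarrow> ennreal" where
  "bayes_risk M L P = (INF f\<in>predictors M. risk L P f)"

(* Truncated subtraction in ennreal is harmless here: risk >= bayes_risk for f in predictors M.
   If the risk is infinite and the Bayes risk is finite, the difference is infinite. *)
definition excess_risk :: "'a measure \<Rightarrow> 'n::finite loss \<Rightarrow> ('a \<times> 'n) measure \<Rightarrow> ('a \<Rightarrow> real ^ 'n) \<Rightarrow> ennreal" where
  "excess_risk M L P f = risk L P f - bayes_risk M L P"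

definition matrix_norm1 :: "real ^ 'n ^ 'n \<Rightarrow> real" where
  "matrix_norm1 A = Max (range (\<lambda>j. \<Sum>i\<in>UNIV. \<bar>A $ i $ j\<bar>))"

definition theta_lower :: "real ^ 'n ^ 'n \<Rightarrow> ennreal \<Rightarrow> ennreal" where
  "theta_lower T \<epsilon> = 1 / 2 * (\<epsilon>\<^sup>2 / (ennreal (matrix_norm1 (matrix_inv T)))\<^sup>2)"

definition ennreal_sqrt :: "ennreal \<Rightarrow> ennreal" where
  "ennreal_sqrt x = (if x = \<infinity> then \<infinity> else ennreal (sqrt (enn2real x)))"

lemma noisy_joint_rectangle:
  fixes P :: "('a \<times> 'n::finite) measure"
  assumes P: "sets P = sets (feature_label_space M)" and A: "A \<in> sets M"
  shows "emeasure (noisy_joint P T) ((A \<times> {i}) \<times> {j}) = emeasure P (A \<times> {i}) * ennreal (T $ j $ i)"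
proof -
  interpret cs: sigma_finite_measure "count_space (UNIV :: 'n set)"
    by (rule sigma_finite_measure_count_space_finite) simp
  have sP [measurable_cong]: "sets P = sets (M \<Otimes>\<^sub>M count_space UNIV)"
    using P by (simp add: feature_label_space_def)
  have Ai [measurable]: "A \<times> {i} \<in> sets P" unfolding sP using A by simp
  have m: "(\<lambda>((x, i), j). ennreal (T $ j $ i)) \<in> borel_measurable (P \<Otimes>\<^sub>M count_space UNIV)"
  proof -
    have 1: "(\<lambda>w. snd (fst w)) \<in> P \<Otimes>\<^sub>M count_space (UNIV :: 'n set) \<rightarrow>\<^sub>M count_space (UNIV :: 'n set)"
      by (rule measurable_compose[OF measurable_fst]) (simp add: measurable_cong_sets[OF sP refl])
    have 2: "snd \<in> P \<Otimes>\<^sub>M count_space (UNIV :: 'n set) \<rightarrow>\<^sub>M count_space (UNIV :: 'n set)"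
      by (rule measurable_snd)
    have "(\<lambda>w. ennreal (T $ snd w $ snd (fst w))) \<in> borel_measurable (P \<Otimes>\<^sub>M count_space UNIV)"
      by (rule measurable_compose_countable'[OF _ 1], rule measurable_compose_countable'[OF _ 2])
        (auto intro: countable_finite)
    then show ?thesis by (simp add: case_prod_beta')
  qed
  have S: "(A \<times> {i}) \<times> {j} \<in> sets (P \<Otimes>\<^sub>M count_space UNIV)" by simp
  have "emeasure (noisy_joint P T) ((A \<times> {i}) \<times> {j})
      = (\<integral>\<^sup>+ w. (\<lambda>((x, i), j). ennreal (T $ j $ i)) w * indicator ((A \<times> {i}) \<times> {j}) w
          \<partial>(P \<Otimes>\<^sub>M count_space UNIV))"
    unfolding noisy_joint_def by (rule emeasure_density[OF m S])
  also have "\<dots> = (\<integral>\<^sup>+ w. ennreal (T $ j $ i) * indicator ((A \<times> {i}) \<times> {j}) w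
          \<partial>(P \<Otimes>\<^sub>M count_space UNIV))"
    by (intro nn_integral_cong) (auto split: split_indicator)
  also have "\<dots> = ennreal (T $ j $ i) * emeasure (P \<Otimes>\<^sub>M count_space UNIV) ((A \<times> {i}) \<times> {j})"
    by (rule nn_integral_cmult_indicator[OF S])
  also have "emeasure (P \<Otimes>\<^sub>M count_space UNIV) ((A \<times> {i}) \<times> {j}) = emeasure P (A \<times> {i})"
    by (subst cs.emeasure_pair_measure_Times) simp_all
  finally show ?thesis by (simp add: mult.commute)
qed

lemma matrix_norm1_inv_pos:
  fixes T :: "real ^ 'n ^ 'n"
  assumes "invertible T"
  shows "0 < matrix_norm1 (matrix_inv T)"
proof (rule ccontr)
  assume *: "\<not> 0 < matrix_norm1 (matrix_inv T)"
  have "(\<Sum>i\<in>UNIV. \<bar>matrix_inv T $ i $ j\<bar>) \<le> matrix_norm1 (matrix_inv T)" for j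
    unfolding matrix_norm1_def by (rule Max_ge) auto
  with * have "(\<Sum>i\<in>UNIV. \<bar>matrix_inv T $ i $ j\<bar>) \<le> 0" for j
    by (meson leI order_trans)
  then have "(\<Sum>i\<in>UNIV. \<bar>matrix_inv T $ i $ j\<bar>) = 0" for j
    by (intro antisym sum_nonneg) auto
  then have "matrix_inv T $ i $ j = 0" for i j
    by (simp add: sum_nonneg_eq_0_iff)
  then have "matrix_inv T = 0" by (simp add: vec_eq_iff)
  moreover have "T ** matrix_inv T = mat 1"
    using someI_ex[OF assms[unfolded invertible_def]] by (simp add: matrix_inv_def)
  ultimately have "(mat 1 :: real ^ 'n ^ 'n) = 0"
    by (simp add: matrix_matrix_mult_def zero_vec_def vec_eq_iff)
  then have "(mat 1 :: real ^ 'n ^ 'n) $ i $ i = 0" for i by simp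
  then show False by (simp add: mat_def)
qed

(* Hence inv (theta_lower T) is the genuine inverse on [0,\<infinity>]. *)
lemma bij_theta_lower:
  fixes T :: "real ^ 'n ^ 'n"
  assumes "invertible T"
  shows "bij (theta_lower T)"
proof -
  define a where "a = matrix_norm1 (matrix_inv T)"
  have a: "0 < a" unfolding a_def by (rule matrix_norm1_inv_pos[OF assms])
  have half: "(1::ennreal) / 2 = ennreal (1 / 2)"
    using ennreal_divide_numeral[of 1 "num.Bit0 num.One"] by simp
  have fin: "theta_lower T (ennreal r) = ennreal (1 / 2 * (r\<^sup>2 / a\<^sup>2))" if "0 \<le> r" for r
    using that a
    by (simp add: theta_lower_def a_def[symmetric] half ennreal_power divide_ennreal
        ennreal_mult[symmetric] del: ennreal_half)
  have fin_top: "theta_lower T top = top"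
    using a by (simp add: theta_lower_def a_def[symmetric] half ennreal_power
        ennreal_top_divide ennreal_mult_eq_top_iff power2_eq_square)
  have "theta_lower T x = theta_lower T y \<Longrightarrow> x = y" for x y
  proof (cases x; cases y)
    fix r s assume "theta_lower T x = theta_lower T y" "0 \<le> r" "x = ennreal r" "0 \<le> s" "y = ennreal s"
    then show "x = y" using a by (simp add: fin)
  qed (auto simp: fin fin_top)
  moreover have "\<exists>x. y = theta_lower T x" for y
  proof (cases y)
    case (real r)
    then have "y = theta_lower T (ennreal (sqrt (2 * r) * a))"
      using a by (simp add: fin power_mult_distrib)
    then show ?thesis ..
  next
    case top
    then show ?thesis using fin_top by metis
  qed
  ultimately show ?thesis by (auto simp: bij_def inj_def surj_def)
qed

end

theory Submission
  imports Defs
begin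

text \<open>Let \<open>\<eta>\<close> be the conditional label distribution of \<open>P\<close>. The excess 0-1 risk of \<open>f\<close> is at most the
  mean of \<open>\<parallel>\<eta> - f\<parallel>\<^sub>1\<close>. Under the noisy law, whose conditional label distribution is \<open>T\<eta>\<close>, the excess
  log risk is at least its excess over the predictor \<open>\<eta>\<close>, that is, the mean of the Kullback-Leibler
  divergence of \<open>T\<eta>\<close> from \<open>Tf\<close>; by Pinsker's inequality this is at least the mean of
  \<open>\<parallel>T\<eta> - Tf\<parallel>\<^sub>1\<^sup>2 / 2\<close>. The two are linked by \<open>\<parallel>\<eta> - f\<parallel>\<^sub>1 \<le> \<parallel>T\<^sup>-\<^sup>1\<parallel>\<^sub>1 \<parallel>T\<eta> - Tf\<parallel>\<^sub>1\<close> and Cauchy-Schwarz.\<close>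

section \<open>Pinsker's inequality\<close>

text \<open>With \<open>u = a / b\<close> the claim is \<open>g u \<ge> 0\<close> for a convex \<open>g\<close> with \<open>g 1 = g' 1 = 0\<close>. The case
  \<open>a = 0\<close> relies on \<open>0 * ln 0 = 0\<close>.\<close>

lemma log_ratio_bound:
  fixes a b :: real
  assumes "0 \<le> a" "0 \<le> b" "b = 0 \<longrightarrow> a = 0"
  shows "3 * (a - b)\<^sup>2 \<le> (2 * a + 4 * b) * (a * (ln a - ln b) - a + b)"
proof (cases "a = 0 \<or> b = 0")
  case True
  then show ?thesis using assms by (auto simp: power2_eq_square)
next
  case False
  with assms have pos: "0 < a" "0 < b" by auto
  define u where "u = a / b"
  have u: "0 < u" using pos by (simp add: u_def)
  \<comment> \<open>Division of the claim by \<open>2 * b^2 * (u + 2)\<close> turns it into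
    \<open>0 \<le> g u\<close>.\<close>
  define g where "g = (\<lambda>u::real. u * ln u - u + 1 - 3/2 * ((u - 1)\<^sup>2 / (u + 2)))"
  \<comment> \<open>From \<open>(u - 1)^2 / (u + 2) = u - 4 + 9 / (u + 2)\<close> come the constants
    3/2 and 27/2 here and 27 in \<open>g''\<close>.\<close>
  define g' where "g' = (\<lambda>u::real. ln u - 3/2 + 27/2 / (u + 2)\<^sup>2)"
  define g'' where "g'' = (\<lambda>u::real. 1 / u - 27 / (u + 2) ^ 3)"
  have "(g has_real_derivative g' x) (at x)" if "x \<in> {0<..}" for x
    using that unfolding g_def g'_def
    by (auto intro!: derivative_eq_intros)
      (simp add: divide_simps, simp add: algebra_simps power2_eq_square)
  moreover have "(g' has_real_derivative g'' x) (at x)" if "x \<in> {0<..}" for x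
    using that unfolding g''_def g'_def
    by (auto intro!: derivative_eq_intros)
      (simp add: divide_simps, simp add: algebra_simps power_numeral_reduce)
  moreover have "0 \<le> g'' x" if "x \<in> {0<..}" for x
  proof -
    \<comment> \<open>The cubic \<open>(x + 2)^3 - 27 * x\<close> has a double root at 1, the point
      where the bound is tight.\<close>
    have "0 \<le> (x - 1)\<^sup>2 * (x + 8)" using that by auto
    also have "\<dots> = (x + 2) ^ 3 - 27 * x" by (simp add: algebra_simps power_numeral_reduce)
    finally show ?thesis using that by (simp add: g''_def field_simps)
  qed
  ultimately have "g' 1 * (u - 1) \<le> g u - g 1"
    by (intro f''_imp_f'[of "{0<..}" g g' g'']) (use u in auto)
  then have g: "0 \<le> g u" by (simp add: g_def g'_def)
  have ln: "ln u = ln a - ln b" using pos by (simp add: u_def ln_div)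
  have a: "a = u * b" using pos by (simp add: u_def)
  have "3 * (u - 1)\<^sup>2 \<le> (2 * u + 4) * (u * ln u - u + 1)"
    using g u by (simp add: g_def field_simps)
  then have "b\<^sup>2 * (3 * (u - 1)\<^sup>2) \<le> b\<^sup>2 * ((2 * u + 4) * (u * ln u - u + 1))"
    by (intro mult_left_mono) auto
  then show ?thesis unfolding ln[symmetric] unfolding a
    by (simp add: algebra_simps power2_eq_square)
qed

text \<open>Cauchy-Schwarz is applied to the termwise bound of \<open>log_ratio_bound\<close>, whose
  weights \<open>s i\<close> sum to 2; this is the constant on the right. The premise
  \<open>ac\<close> rules out infinite divergence, which the convention \<open>ln 0 = 0\<close>
  would hide.\<close>

lemma pinsker:
  fixes p q :: "real ^ 'n::finite"
  assumes p: "p \<in> prob_simplex" and q: "q \<in> prob_simplex"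
    and ac: "\<And>i. q $ i = 0 \<Longrightarrow> p $ i = 0"
  shows "(\<Sum>i\<in>UNIV. \<bar>p $ i - q $ i\<bar>)\<^sup>2 \<le> 2 * (\<Sum>i\<in>UNIV. p $ i * (ln (p $ i) - ln (q $ i)))"
proof -
  have p0: "0 \<le> p $ i" and q0: "0 \<le> q $ i" for i
    using p q by (auto simp: prob_simplex_def)
  have sums: "(\<Sum>i\<in>UNIV. p $ i) = 1" "(\<Sum>i\<in>UNIV. q $ i) = 1"
    using p q by (auto simp: prob_simplex_def)
  define s where "s i = (2 * p $ i + 4 * q $ i) / 3" for i
  \<comment> \<open>The added \<open>- p $ i + q $ i\<close> sum to 0 and make every term
    nonnegative, so that \<open>sqrt (t i)\<close> squares back to \<open>t i\<close>.\<close>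
  define t where "t i = p $ i * (ln (p $ i) - ln (q $ i)) - p $ i + q $ i" for i
  have s0: "0 \<le> s i" for i using p0 q0 by (simp add: s_def)
  have st: "(p $ i - q $ i)\<^sup>2 \<le> s i * t i" for i
    using log_ratio_bound[OF p0 q0, of i i] ac[of i] by (simp add: s_def t_def)
  have t0: "0 \<le> t i" for i
  \<comment> \<open>If \<open>s i = 0\<close>, the product bound says nothing about
    \<open>t i\<close>, but then \<open>p $ i\<close> and \<open>q $ i\<close> both vanish.\<close>
  proof (cases "s i = 0")
    case True
    then have "p $ i = 0" "q $ i = 0" using p0[of i] q0[of i] by (auto simp: s_def)
    then show ?thesis by (simp add: t_def)
  next
    case False
    have "0 \<le> s i * t i" using st[of i] zero_le_power2 order_trans by blast
    then show ?thesis using s0[of i] False by (simp add: zero_le_mult_iff)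
  qed
  have "\<bar>p $ i - q $ i\<bar> \<le> sqrt (s i) * sqrt (t i)" for i
    using st[of i] by (metis real_sqrt_abs real_sqrt_le_iff real_sqrt_mult)
  then have "(\<Sum>i\<in>UNIV. \<bar>p $ i - q $ i\<bar>) \<le> (\<Sum>i\<in>UNIV. sqrt (s i) * sqrt (t i))"
    by (rule sum_mono)
  then have "(\<Sum>i\<in>UNIV. \<bar>p $ i - q $ i\<bar>)\<^sup>2 \<le> (\<Sum>i\<in>UNIV. sqrt (s i) * sqrt (t i))\<^sup>2"
    by (intro power_mono sum_nonneg) auto
  also have "\<dots> \<le> (\<Sum>i\<in>UNIV. (sqrt (s i))\<^sup>2) * (\<Sum>i\<in>UNIV. (sqrt (t i))\<^sup>2)"
    by (rule Cauchy_Schwarz_ineq_sum)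
  also have "\<dots> = (\<Sum>i\<in>UNIV. s i) * (\<Sum>i\<in>UNIV. t i)"
    using s0 t0 by simp
  also have "(\<Sum>i\<in>UNIV. s i) = 2"
    by (simp add: s_def sum_divide_distrib[symmetric] sum.distrib sum_distrib_left[symmetric] sums)
  also have "(\<Sum>i\<in>UNIV. t i) = (\<Sum>i\<in>UNIV. p $ i * (ln (p $ i) - ln (q $ i)))"
    by (simp add: t_def sum.distrib sum_subtractf sums)
  finally show ?thesis .
qed

section \<open>Pointwise excess of the log loss\<close>

lemma prob_simplex_le_1:
  fixes p :: "real ^ 'n::finite"
  assumes "p \<in> prob_simplex"
  shows "p $ i \<le> 1"
  using assms member_le_sum[of i UNIV "\<lambda>i. p $ i"] by (simp add: prob_simplex_def)

text \<open>The right side is the entropy. A label of probability 0 has infinite loss but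
  contributes 0, as \<open>0 * \<infinity> = 0\<close> in \<open>ennreal\<close>.\<close>

lemma sum_log_loss_self:
  fixes p :: "real ^ 'n::finite"
  assumes p: "p \<in> prob_simplex"
  shows "(\<Sum>i\<in>UNIV. ennreal (p $ i) * log_loss p i) = ennreal (\<Sum>i\<in>UNIV. - (p $ i * ln (p $ i)))"
proof -
  have p0: "0 \<le> p $ i" for i using p by (auto simp: prob_simplex_def)
  have ln: "ln (p $ i) \<le> 0" if "p $ i \<noteq> 0" for i
    using prob_simplex_le_1[OF p, of i] p0[of i] that by simp
  have le: "0 \<le> - (p $ i * ln (p $ i))" for i
    using ln[of i] p0[of i] by (cases "p $ i = 0") (auto simp: mult_nonneg_nonpos)
  have "ennreal (p $ i) * log_loss p i = ennreal (- (p $ i * ln (p $ i)))" for i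
    using ln[of i] p0[of i] by (simp add: log_loss_def ennreal_mult[symmetric])
  then show ?thesis using le by (simp add: sum_ennreal)
qed

text \<open>Cross-entropy is entropy plus divergence, and Pinsker's inequality bounds the
  divergence. If \<open>q\<close> vanishes somewhere that \<open>p\<close> does not, the right side
  is infinite. The additive form keeps clear of truncated subtraction.\<close>

lemma sum_log_loss_excess:
  fixes p q :: "real ^ 'n::finite"
  assumes p: "p \<in> prob_simplex" and q: "q \<in> prob_simplex"
  shows "(\<Sum>i\<in>UNIV. ennreal (p $ i) * log_loss p i)
           + ennreal ((\<Sum>i\<in>UNIV. \<bar>p $ i - q $ i\<bar>)\<^sup>2 / 2)
         \<le> (\<Sum>i\<in>UNIV. ennreal (p $ i) * log_loss q i)"
proof (cases "\<exists>i. q $ i = 0 \<and> p $ i \<noteq> 0")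
  case True
  then obtain i where i: "q $ i = 0" "p $ i \<noteq> 0" by blast
  then have "0 < p $ i" using p by (auto simp: prob_simplex_def less_le)
  then have "ennreal (p $ i) * log_loss q i = top" using i
    by (simp add: log_loss_def ennreal_mult_top)
  then have "(\<Sum>i\<in>UNIV. ennreal (p $ i) * log_loss q i) = top"
    by (subst sum.remove[of _ i]) auto
  then show ?thesis by (simp only: top_greatest)
next
  case False
  then have ac: "\<And>i. q $ i = 0 \<Longrightarrow> p $ i = 0" by blast
  have p0: "0 \<le> p $ i" and q0: "0 \<le> q $ i" for i
    using p q by (auto simp: prob_simplex_def)
  have ln: "ln (q $ i) \<le> 0" if "q $ i \<noteq> 0" for i
    using prob_simplex_le_1[OF q, of i] q0[of i] that by simp
  have le: "0 \<le> - (p $ i * ln (q $ i))" for i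
    using ln[of i] p0[of i] ac[of i] by (cases "q $ i = 0") (auto simp: mult_nonneg_nonpos)
  have "ennreal (p $ i) * log_loss q i = ennreal (- (p $ i * ln (q $ i)))" for i
    using ln[of i] p0[of i] ac[of i] by (auto simp: log_loss_def ennreal_mult[symmetric])
  then have cross: "(\<Sum>i\<in>UNIV. ennreal (p $ i) * log_loss q i) = ennreal (\<Sum>i\<in>UNIV. - (p $ i * ln (q $ i)))"
    using le by (simp add: sum_ennreal)
  have lep: "0 \<le> - (p $ i * ln (p $ i))" for i
    using prob_simplex_le_1[OF p, of i] p0[of i]
    by (cases "p $ i = 0") (auto simp: mult_nonneg_nonpos)
  have "(\<Sum>i\<in>UNIV. - (p $ i * ln (p $ i))) + (\<Sum>i\<in>UNIV. \<bar>p $ i - q $ i\<bar>)\<^sup>2 / 2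
      \<le> (\<Sum>i\<in>UNIV. - (p $ i * ln (q $ i)))"
    using pinsker[OF p q ac] by (simp add: right_diff_distrib sum_subtractf sum_negf)
  then show ?thesis
    unfolding sum_log_loss_self[OF p] cross
    using lep by (subst ennreal_plus[symmetric]) (auto intro!: sum_nonneg ennreal_leI simp del: ennreal_plus)
qed

section \<open>The noise matrix and the 1-norm\<close>

lemma column_stochastic_simplex:
  fixes T :: "real ^ 'n::finite ^ 'n"
  assumes T: "column_stochastic T" and p: "p \<in> prob_simplex"
  shows "T *v p \<in> prob_simplex"
proof -
  have "(\<Sum>i\<in>UNIV. \<Sum>j\<in>UNIV. T $ i $ j * p $ j) = (\<Sum>j\<in>UNIV. (\<Sum>i\<in>UNIV. T $ i $ j) * p $ j)"
    by (subst sum.swap) (simp add: sum_distrib_right)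
  then show ?thesis using T p
    by (auto simp: prob_simplex_def column_stochastic_def matrix_vector_mult_def intro!: sum_nonneg)
qed

lemma matrix_norm1_bound:
  fixes A :: "real ^ 'n::finite ^ 'n" and w :: "real ^ 'n"
  shows "(\<Sum>i\<in>UNIV. \<bar>(A *v w) $ i\<bar>) \<le> matrix_norm1 A * (\<Sum>j\<in>UNIV. \<bar>w $ j\<bar>)"
proof -
  have "(\<Sum>i\<in>UNIV. \<bar>(A *v w) $ i\<bar>) \<le> (\<Sum>i\<in>UNIV. \<Sum>j\<in>UNIV. \<bar>A $ i $ j\<bar> * \<bar>w $ j\<bar>)"
    by (intro sum_mono) (auto simp: matrix_vector_mult_def abs_mult[symmetric] intro!: sum_abs)
  also have "\<dots> = (\<Sum>j\<in>UNIV. (\<Sum>i\<in>UNIV. \<bar>A $ i $ j\<bar>) * \<bar>w $ j\<bar>)"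
    by (subst sum.swap) (simp add: sum_distrib_right)
  also have "\<dots> \<le> (\<Sum>j\<in>UNIV. matrix_norm1 A * \<bar>w $ j\<bar>)"
    unfolding matrix_norm1_def by (intro sum_mono mult_right_mono Max_ge) auto
  finally show ?thesis by (simp add: sum_distrib_left)
qed

text \<open>\<open>matrix_inv T\<close> maps \<open>T *v (p - q)\<close> back to
  \<open>p - q\<close>; its norm measures how strongly the noise can shrink 1-norm
  distances.\<close>

lemma inverse_noise_bound:
  fixes T :: "real ^ 'n::finite ^ 'n" and p q :: "real ^ 'n"
  assumes "invertible T"
  shows "(\<Sum>i\<in>UNIV. \<bar>p $ i - q $ i\<bar>)
           \<le> matrix_norm1 (matrix_inv T) * (\<Sum>i\<in>UNIV. \<bar>(T *v p) $ i - (T *v q) $ i\<bar>)"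
proof -
  have "matrix_inv T *v (T *v (p - q)) = p - q"
    using someI_ex[OF assms[unfolded invertible_def]]
    by (simp add: matrix_vector_mul_assoc matrix_inv_def)
  then show ?thesis
    using matrix_norm1_bound[of "matrix_inv T" "T *v (p - q)"]
    by (simp add: matrix_vector_mult_diff_distrib)
qed

section \<open>Pointwise excess of the 0-1 loss\<close>

abbreviation predicted_label :: "real ^ 'n::{finite,linorder} \<Rightarrow> 'n" where
  "predicted_label q \<equiv> Min {j. is_arg_max (\<lambda>j. q $ j) (\<lambda>_. True) j}"

lemma predicted_label_max:
  fixes q :: "real ^ 'n::{finite,linorder}"
  shows "q $ j \<le> q $ predicted_label q"
proof -
  have "Max (range (($) q)) \<in> range (($) q)" by (rule Max_in) auto
  then obtain k where "Max (range (($) q)) = q $ k" by (rule rangeE)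
  then have "q $ j \<le> q $ k" for j
    using Max_ge[of "range (($) q)" "q $ j"] by simp
  then have "k \<in> {j. is_arg_max (\<lambda>j. q $ j) (\<lambda>_. True) j}" by (auto simp: is_arg_max_def not_less)
  then have "predicted_label q \<in> {j. is_arg_max (\<lambda>j. q $ j) (\<lambda>_. True) j}"
    by (intro Min_in) auto
  then show ?thesis by (simp add: is_arg_max_def not_less)
qed

lemma sum_zero_one_loss:
  fixes p q :: "real ^ 'n::{finite,linorder}"
  assumes p: "p \<in> prob_simplex"
  shows "(\<Sum>i\<in>UNIV. ennreal (p $ i) * zero_one_loss q i) = ennreal (1 - p $ predicted_label q)"
proof -
  have p0: "0 \<le> p $ i" for i using p by (auto simp: prob_simplex_def)
  have "(\<Sum>i\<in>UNIV. ennreal (p $ i) * zero_one_loss q i) = (\<Sum>i\<in>UNIV - {predicted_label q}. ennreal (p $ i))"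
    by (subst sum.remove[of _ "predicted_label q"]) (auto simp: zero_one_loss_def intro!: sum.cong)
  also have "\<dots> = ennreal (\<Sum>i\<in>UNIV - {predicted_label q}. p $ i)"
    using p0 by (simp add: sum_ennreal)
  also have "(\<Sum>i\<in>UNIV - {predicted_label q}. p $ i) = 1 - p $ predicted_label q"
    using p by (simp add: prob_simplex_def sum_diff1)
  finally show ?thesis .
qed

text \<open>With \<open>h\<close> and \<open>k\<close> the labels chosen by \<open>q\<close> and
  \<open>r\<close>, \<open>q $ k \<le> q $ h\<close> gives
  \<open>p $ k - p $ h \<le> (p $ k - q $ k) + (q $ h - p $ h)\<close>, bounded by two terms of the
  1-norm distance if \<open>h\<close> and \<open>k\<close> differ. The competitor \<open>r\<close>
  is arbitrary, to allow an infimum later.\<close>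

lemma sum_zero_one_loss_excess:
  fixes p q r :: "real ^ 'n::{finite,linorder}"
  assumes p: "p \<in> prob_simplex"
  shows "(\<Sum>i\<in>UNIV. ennreal (p $ i) * zero_one_loss q i)
     \<le> (\<Sum>i\<in>UNIV. ennreal (p $ i) * zero_one_loss r i) + ennreal (\<Sum>i\<in>UNIV. \<bar>p $ i - q $ i\<bar>)"
proof -
  let ?h = "predicted_label q" and ?k = "predicted_label r"
  have "p $ ?k - p $ ?h \<le> (\<Sum>i\<in>UNIV. \<bar>p $ i - q $ i\<bar>)"
  proof (cases "?k = ?h")
    case False
    have "p $ ?k - p $ ?h \<le> (\<Sum>i\<in>{?k, ?h}. \<bar>p $ i - q $ i\<bar>)"
      using False predicted_label_max[of q ?k] by simp
    also have "\<dots> \<le> (\<Sum>i\<in>UNIV. \<bar>p $ i - q $ i\<bar>)"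
      by (rule sum_mono2) auto
    finally show ?thesis .
  qed (simp add: sum_nonneg)
  then show ?thesis
    unfolding sum_zero_one_loss[OF p]
    using prob_simplex_le_1[OF p]
    by (subst ennreal_plus[symmetric]) (auto intro!: sum_nonneg ennreal_leI simp del: ennreal_plus)
qed

section \<open>Conditional label distributions, clean and noisy\<close>

text \<open>With finitely many labels, \<open>\<eta>\<close> can be assembled from Radon-Nikodym
  derivatives with respect to the feature marginal: one for each measure sending \<open>A\<close> to
  the mass of \<open>A \<times> {i}\<close> under \<open>P\<close>. The result is a rule for
  integrals because risks are integrals of such \<open>F\<close>.\<close>

lemma conditional_distribution:
  fixes P :: "('a \<times> 'n::finite) measure"
  assumes P: "prob_measure_on (feature_label_space M) P"
  shows "\<exists>\<eta>\<in>predictors M. \<forall>F. (\<forall>i. F i \<in> borel_measurable M) \<longrightarrow>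
          (\<integral>\<^sup>+ z. F (snd z) (fst z) \<partial>P) = (\<integral>\<^sup>+ x. (\<Sum>i\<in>UNIV. ennreal (\<eta> x $ i) * F i x) \<partial>distr P M fst)"
proof -
  interpret prob_space P using P by (simp add: prob_measure_on_def)
  have sP [measurable_cong]: "sets P = sets (M \<Otimes>\<^sub>M count_space UNIV)"
    using P by (simp add: prob_measure_on_def feature_label_space_def)
  define \<mu> where "\<mu> = distr P M fst"
  have s\<mu> [measurable_cong]: "sets \<mu> = sets M" by (simp add: \<mu>_def)
  interpret \<mu>: prob_space \<mu> unfolding \<mu>_def by (rule prob_space_distr) measurable
  define \<nu> where "\<nu> i = distr (density P (\<lambda>z. indicator {i} (snd z))) M fst" for i
  have \<nu>: "(\<integral>\<^sup>+ x. h x \<partial>\<nu> i) = (\<integral>\<^sup>+ z. indicator {i} (snd z) * h (fst z) \<partial>P)"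
    if [measurable]: "h \<in> borel_measurable M" for i h
    unfolding \<nu>_def by (subst nn_integral_distr, simp, measurable) (simp add: nn_integral_density)
  have total: "(\<integral>\<^sup>+ z. F (snd z) (fst z) \<partial>P) = (\<Sum>i\<in>UNIV. \<integral>\<^sup>+ x. F i x \<partial>\<nu> i)"
    if [measurable]: "\<And>i. F i \<in> borel_measurable M" for F :: "'n \<Rightarrow> 'a \<Rightarrow> ennreal"
  proof -
    have "(\<integral>\<^sup>+ z. F (snd z) (fst z) \<partial>P)
        = (\<integral>\<^sup>+ z. (\<Sum>i\<in>UNIV. indicator {i} (snd z) * F i (fst z)) \<partial>P)"
      by (intro nn_integral_cong) (simp add: indicator_def if_distrib[of "\<lambda>x. x * _"] cong: if_cong)
    also have "\<dots> = (\<Sum>i\<in>UNIV. \<integral>\<^sup>+ x. F i x \<partial>\<nu> i)"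
      by (subst nn_integral_sum) (simp_all add: \<nu>)
    finally show ?thesis .
  qed
  \<comment> \<open>A set of features that is null for the marginal is null jointly with any
    label.\<close>
  have ac: "absolutely_continuous \<mu> (\<nu> i)" for i
    unfolding absolutely_continuous_def
  proof
    fix A assume "A \<in> null_sets \<mu>"
    then have A [measurable]: "A \<in> sets M" and "emeasure \<mu> A = 0" by (auto simp: null_sets_def s\<mu>)
    then have 0: "(\<integral>\<^sup>+ z. indicator A (fst z) \<partial>P) = 0"
      unfolding \<mu>_def by (simp add: nn_integral_indicator[symmetric] nn_integral_distr del: nn_integral_indicator)
    have "emeasure (\<nu> i) A = (\<integral>\<^sup>+ x. indicator A x \<partial>\<nu> i)"
      by (rule nn_integral_indicator[symmetric]) (simp add: \<nu>_def)
    also have "\<dots> \<le> (\<integral>\<^sup>+ z. indicator A (fst z) \<partial>P)"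
      by (subst \<nu>) (auto intro!: nn_integral_mono split: split_indicator)
    finally show "A \<in> null_sets (\<nu> i)" using 0 A by (auto simp: null_sets_def \<nu>_def)
  qed
  have "\<exists>g. g \<in> borel_measurable M \<and> density \<mu> g = \<nu> i" for i
    using \<mu>.Radon_Nikodym[OF ac, of i] by (auto simp: \<nu>_def s\<mu> measurable_cong_sets[OF s\<mu> refl])
  then obtain g where g [measurable]: "\<And>i. g i \<in> borel_measurable M" and dg: "\<And>i. density \<mu> (g i) = \<nu> i"
    by metis
  have disint: "(\<integral>\<^sup>+ z. F (snd z) (fst z) \<partial>P) = (\<integral>\<^sup>+ x. (\<Sum>i\<in>UNIV. g i x * F i x) \<partial>\<mu>)"
    if [measurable]: "\<And>i. F i \<in> borel_measurable M" for F :: "'n \<Rightarrow> 'a \<Rightarrow> ennreal"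
    by (subst total) (simp_all add: dg[symmetric] nn_integral_density nn_integral_sum)
  \<comment> \<open>Test functions that ignore the label recover the marginal, so the sum of the
    densities and the constant 1 have the same integral over every set.\<close>
  have "AE x in \<mu>. (\<Sum>i\<in>UNIV. g i x) = 1"
  proof (rule \<mu>.density_unique2)
    fix A assume "A \<in> sets \<mu>"
    then have [measurable]: "A \<in> sets M" by (simp add: s\<mu>)
    have "(\<integral>\<^sup>+ x\<in>A. (\<Sum>i\<in>UNIV. g i x) \<partial>\<mu>) = (\<integral>\<^sup>+ z. indicator A (fst z) \<partial>P)"
      using disint[of "\<lambda>_. indicator A"] by (simp add: sum_distrib_right)
    also have "\<dots> = (\<integral>\<^sup>+ x\<in>A. 1 \<partial>\<mu>)"
      unfolding \<mu>_def by (subst nn_integral_distr) simp_all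
    finally show "(\<integral>\<^sup>+ x\<in>A. (\<Sum>i\<in>UNIV. g i x) \<partial>\<mu>) = (\<integral>\<^sup>+ x\<in>A. 1 \<partial>\<mu>)" .
  qed measurable
  \<comment> \<open>On the null set where the densities do not sum to 1, \<open>\<eta>\<close> is replaced by a fixed vertex of the simplex.\<close>
  define i0 :: 'n where "i0 = undefined"
  define \<eta> :: "'a \<Rightarrow> real ^ 'n" where
    "\<eta> x = (\<chi> i. if (\<Sum>i\<in>UNIV. g i x) = 1 then enn2real (g i x) else of_bool (i = i0))" for x
  have \<eta>_eq: "ennreal (\<eta> x $ i) = g i x" if "(\<Sum>i\<in>UNIV. g i x) = 1" for x i
  proof -
    \<comment> \<open>Each summand is at most the sum 1, hence finite, so \<open>enn2real\<close>
      loses nothing.\<close>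
    have "g i x \<le> (\<Sum>i\<in>UNIV. g i x)" by (rule member_le_sum) auto
    with that have "g i x < top" using ennreal_one_less_top order_le_less_trans by metis
    with that show ?thesis by (simp add: \<eta>_def ennreal_enn2real_if)
  qed
  have \<eta>_nonneg: "0 \<le> \<eta> x $ i" for x i by (simp add: \<eta>_def)
  have simplex: "\<eta> x \<in> prob_simplex" for x
  proof (cases "(\<Sum>i\<in>UNIV. g i x) = 1")
    case True
    have "ennreal (\<Sum>i\<in>UNIV. \<eta> x $ i) = (\<Sum>i\<in>UNIV. ennreal (\<eta> x $ i))"
      by (rule sum_ennreal[symmetric]) (rule \<eta>_nonneg)
    also have "\<dots> = ennreal 1" by (simp add: \<eta>_eq[OF True] True)
    finally have "(\<Sum>i\<in>UNIV. \<eta> x $ i) = 1"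
      by (subst (asm) ennreal_inj) (auto intro!: sum_nonneg simp: \<eta>_nonneg)
    then show ?thesis by (simp add: prob_simplex_def \<eta>_nonneg)
  next
    case False
    then show ?thesis by (simp add: prob_simplex_def \<eta>_def of_bool_def)
  qed
  have \<eta>_nth: "(\<lambda>x. \<eta> x $ i) \<in> borel_measurable M" for i
    unfolding \<eta>_def by simp
  have "\<eta> \<in> borel_measurable M"
  proof (rule borel_measurable_euclidean_space[THEN iffD2], rule ballI)
    fix b :: "real ^ 'n" assume "b \<in> Basis"
    then obtain i where "b = axis i 1" by (auto simp: Basis_vec_def)
    then show "(\<lambda>x. \<eta> x \<bullet> b) \<in> borel_measurable M"
      using \<eta>_nth[of i] by (simp add: inner_axis)
  qed
  then have "\<eta> \<in> predictors M"
    unfolding predictors_def by (intro measurable_restrict_space2) (auto simp: simplex)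
  moreover have "(\<integral>\<^sup>+ z. F (snd z) (fst z) \<partial>P)
      = (\<integral>\<^sup>+ x. (\<Sum>i\<in>UNIV. ennreal (\<eta> x $ i) * F i x) \<partial>distr P M fst)"
    if F: "\<And>i. F i \<in> borel_measurable M" for F
  proof -
    have "(\<integral>\<^sup>+ x. (\<Sum>i\<in>UNIV. g i x * F i x) \<partial>\<mu>) = (\<integral>\<^sup>+ x. (\<Sum>i\<in>UNIV. ennreal (\<eta> x $ i) * F i x) \<partial>\<mu>)"
      using \<open>AE x in \<mu>. (\<Sum>i\<in>UNIV. g i x) = 1\<close> by (intro nn_integral_cong_AE) (auto simp: \<eta>_eq)
    with disint[of F, OF F] show ?thesis by (simp add: \<mu>_def)
  qed
  ultimately show ?thesis by blast
qed

text \<open>Given \<open>(x, i)\<close>, the noisy label is weighted by column \<open>i\<close> of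
  \<open>T\<close>. Tonelli integrates it out and leaves an integral over \<open>P\<close>, ready
  for disintegration.\<close>

lemma nn_integral_noisy:
  fixes P :: "('a \<times> 'n::finite) measure" and T :: "real ^ 'n ^ 'n"
  assumes P: "prob_measure_on (feature_label_space M) P"
    and F: "\<And>j. F j \<in> borel_measurable M"
  shows "(\<integral>\<^sup>+ z. F (snd z) (fst z) \<partial>noisy M P T)
           = (\<integral>\<^sup>+ z. (\<Sum>j\<in>UNIV. ennreal (T $ j $ snd z) * F j (fst z)) \<partial>P)"
proof -
  interpret cs: sigma_finite_measure "count_space (UNIV :: 'n set)"
    by (rule sigma_finite_measure_count_space_finite) simp
  have sP [measurable_cong]: "sets P = sets (M \<Otimes>\<^sub>M count_space UNIV)"
    using P by (simp add: prob_measure_on_def feature_label_space_def)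
  note F [measurable]
  have F' [measurable]: "(\<lambda>z. F (snd z) (fst z)) \<in> borel_measurable (M \<Otimes>\<^sub>M count_space UNIV)"
    by measurable
  have t [measurable]: "(\<lambda>w. ennreal (T $ snd w $ snd (fst w))) \<in> borel_measurable (P \<Otimes>\<^sub>M count_space UNIV)"
    by measurable
  have "(\<integral>\<^sup>+ z. F (snd z) (fst z) \<partial>noisy M P T)
      = (\<integral>\<^sup>+ w. F (snd w) (fst (fst w)) \<partial>noisy_joint P T)"
    unfolding noisy_def feature_label_space_def
    by (subst nn_integral_distr) (simp_all add: noisy_joint_def case_prod_beta')
  also have "\<dots> = (\<integral>\<^sup>+ w. ennreal (T $ snd w $ snd (fst w)) * F (snd w) (fst (fst w)) \<partial>(P \<Otimes>\<^sub>M count_space UNIV))"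
    unfolding noisy_joint_def case_prod_beta' by (subst nn_integral_density) simp_all
  also have "\<dots> = (\<integral>\<^sup>+ z. (\<integral>\<^sup>+ j. ennreal (T $ j $ snd z) * F j (fst z) \<partial>count_space UNIV) \<partial>P)"
    by (subst cs.nn_integral_fst[symmetric]) simp_all
  finally show ?thesis by (simp add: nn_integral_count_space_finite)
qed

section \<open>Measurability of predictors and losses\<close>

lemma predictors_simplex:
  assumes "g \<in> predictors M" "x \<in> space M"
  shows "g x \<in> prob_simplex"
  using measurable_space[OF assms(1)[unfolded predictors_def] assms(2)] by (simp add: space_restrict_space)

lemma predictors_nth:
  fixes g :: "'a \<Rightarrow> real ^ 'n::finite"
  assumes "g \<in> predictors M"
  shows "(\<lambda>x. g x $ i) \<in> borel_measurable M"
proof -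
  have "g \<in> borel_measurable M"
    using assms by (simp add: predictors_def measurable_restrict_space2_iff)
  then have "(\<lambda>x. g x \<bullet> axis i 1) \<in> borel_measurable M" by (rule borel_measurable_inner) simp
  then show ?thesis by (simp add: inner_axis)
qed

lemma predictors_matrix_mult_nth:
  fixes g :: "'a \<Rightarrow> real ^ 'n::finite" and T :: "real ^ 'n ^ 'n"
  assumes "g \<in> predictors M"
  shows "(\<lambda>x. (T *v g x) $ i) \<in> borel_measurable M"
  using predictors_nth[OF assms] by (simp add: matrix_vector_mult_def)

lemma measurable_forward_log_loss:
  fixes g :: "'a \<Rightarrow> real ^ 'n::finite" and T :: "real ^ 'n ^ 'n"
  assumes "g \<in> predictors M"
  shows "(\<lambda>x. forward_loss T log_loss (g x) i) \<in> borel_measurable M"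
proof -
  note [measurable] = predictors_matrix_mult_nth[OF assms]
  show ?thesis unfolding forward_loss_def log_loss_def by measurable
qed

text \<open>The least maximiser is \<open>i\<close> iff coordinate \<open>i\<close> is maximal and
  each smaller label is strictly beaten by some coordinate: a finite combination of comparisons
  between measurable functions.\<close>

lemma measurable_zero_one_loss:
  fixes g :: "'a \<Rightarrow> real ^ 'n::{finite,linorder}"
  assumes "g \<in> predictors M"
  shows "(\<lambda>x. zero_one_loss (g x) i) \<in> borel_measurable M"
proof -
  note [measurable] = predictors_nth[OF assms]
  have eq: "predicted_label q = i
      \<longleftrightarrow> (\<forall>j. q $ j \<le> q $ i) \<and> (\<forall>k. k < i \<longrightarrow> (\<exists>j. q $ k < q $ j))" for q :: "real ^ 'n::{finite,linorder}"
  proof -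
    let ?A = "{j. is_arg_max (\<lambda>j. q $ j) (\<lambda>_. True) j}"
    have A: "k \<in> ?A \<longleftrightarrow> (\<forall>j. q $ j \<le> q $ k)" for k
      by (simp add: is_arg_max_def not_less)
    have "predicted_label q \<in> ?A"
      unfolding A using predicted_label_max by blast
    then have "predicted_label q = i \<longleftrightarrow> i \<in> ?A \<and> (\<forall>k\<in>?A. i \<le> k)"
      by (subst Min_eq_iff) auto
    then show ?thesis by (metis A not_le)
  qed
  have "(\<lambda>x. zero_one_loss (g x) i)
      = (\<lambda>x. if (\<forall>j. g x $ j \<le> g x $ i) \<and> (\<forall>k. k < i \<longrightarrow> (\<exists>j. g x $ k < g x $ j)) then 0 else 1)"
    unfolding eq[symmetric] by (auto simp: zero_one_loss_def fun_eq_iff)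
  then show ?thesis by simp
qed

section \<open>Excess risks as integrals over the features\<close>

context
  fixes M :: "'a measure" and T :: "real ^ 'n::{finite,linorder} ^ 'n::{finite,linorder}"
    and P :: "('a \<times> 'n::{finite,linorder}) measure"
    and \<eta> :: "'a \<Rightarrow> real ^ 'n::{finite,linorder}" and \<mu> :: "'a measure"
  assumes T: "column_stochastic T" and P: "prob_measure_on (feature_label_space M) P"
    and \<eta>: "\<eta> \<in> predictors M"
    and sets_\<mu>: "sets \<mu> = sets M"
    and disint: "\<forall>F. (\<forall>i. F i \<in> borel_measurable M) \<longrightarrow>
          (\<integral>\<^sup>+ z. F (snd z) (fst z) \<partial>P) = (\<integral>\<^sup>+ x. (\<Sum>i\<in>UNIV. ennreal (\<eta> x $ i) * F i x) \<partial>\<mu>)"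
begin

lemma space_\<mu>: "space \<mu> = space M"
  using sets_\<mu> by (rule sets_eq_imp_space_eq)

lemma borel_measurable_\<mu>: "borel_measurable \<mu> = borel_measurable M"
  using sets_\<mu> by (intro measurable_cong_sets) auto

lemma risk_conditional:
  assumes "\<And>i. (\<lambda>x. L (g x) i) \<in> borel_measurable M"
  shows "risk L P g = (\<integral>\<^sup>+ x. (\<Sum>i\<in>UNIV. ennreal (\<eta> x $ i) * L (g x) i) \<partial>\<mu>)"
  using disint[rule_format, of "\<lambda>i x. L (g x) i", OF assms] by (simp add: risk_def case_prod_beta')

text \<open>Moving the sum over clean labels inside turns \<open>\<eta> x\<close> into
  \<open>T *v \<eta> x\<close>, the conditional law of the noisy label. Nonnegativity of
  \<open>T\<close> and \<open>\<eta>\<close> lets \<open>ennreal\<close> pass through products and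
  sums.\<close>

lemma risk_noisy_conditional:
  assumes L: "\<And>i. (\<lambda>x. L (g x) i) \<in> borel_measurable M"
  shows "risk L (noisy M P T) g = (\<integral>\<^sup>+ x. (\<Sum>j\<in>UNIV. ennreal ((T *v \<eta> x) $ j) * L (g x) j) \<partial>\<mu>)"
proof -
  note L [measurable]
  have t0: "0 \<le> T $ j $ i" for i j using T by (simp add: column_stochastic_def)
  have "risk L (noisy M P T) g
      = (\<integral>\<^sup>+ z. (\<Sum>j\<in>UNIV. ennreal (T $ j $ snd z) * L (g (fst z)) j) \<partial>P)"
    unfolding risk_def case_prod_beta'
    by (rule nn_integral_noisy[OF P, of "\<lambda>j x. L (g x) j", OF L])
  also have "\<dots> = (\<integral>\<^sup>+ x. (\<Sum>i\<in>UNIV. ennreal (\<eta> x $ i) * (\<Sum>j\<in>UNIV. ennreal (T $ j $ i) * L (g x) j)) \<partial>\<mu>)"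
    by (rule disint[rule_format]) measurable
  also have "\<dots> = (\<integral>\<^sup>+ x. (\<Sum>j\<in>UNIV. ennreal ((T *v \<eta> x) $ j) * L (g x) j) \<partial>\<mu>)"
  proof (rule nn_integral_cong)
    fix x assume "x \<in> space \<mu>"
    then have \<eta>0: "0 \<le> \<eta> x $ i" for i
      using predictors_simplex[OF \<eta>] by (simp add: space_\<mu> prob_simplex_def)
    have "(\<Sum>i\<in>UNIV. ennreal (\<eta> x $ i) * (\<Sum>j\<in>UNIV. ennreal (T $ j $ i) * L (g x) j))
        = (\<Sum>j\<in>UNIV. (\<Sum>i\<in>UNIV. ennreal (T $ j $ i) * ennreal (\<eta> x $ i)) * L (g x) j)"
      unfolding sum_distrib_left sum_distrib_right by (subst sum.swap) (simp add: ac_simps)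
    also have "\<dots> = (\<Sum>j\<in>UNIV. ennreal ((T *v \<eta> x) $ j) * L (g x) j)"
      using t0 \<eta>0 by (simp add: matrix_vector_mult_def ennreal_mult[symmetric])
    finally show "(\<Sum>i\<in>UNIV. ennreal (\<eta> x $ i) * (\<Sum>j\<in>UNIV. ennreal (T $ j $ i) * L (g x) j))
        = (\<Sum>j\<in>UNIV. ennreal ((T *v \<eta> x) $ j) * L (g x) j)" .
  qed
  finally show ?thesis .
qed

text \<open>\<open>f\<close> is compared with an arbitrary predictor \<open>g\<close> and the
  infimum over \<open>g\<close> is taken at the end, so no minimiser has to be constructed.\<close>

lemma excess_zero_one_le:
  assumes f: "f \<in> predictors M"
  shows "excess_risk M zero_one_loss P f \<le> (\<integral>\<^sup>+ x. ennreal (\<Sum>i\<in>UNIV. \<bar>\<eta> x $ i - f x $ i\<bar>) \<partial>\<mu>)"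
    (is "_ \<le> ?D")
proof -
  interpret prob_space P using P by (simp add: prob_measure_on_def)
  \<comment> \<open>The 0-1 risk is at most 1; its finiteness allows \<open>?D\<close> to be moved
    across the truncated subtraction.\<close>
  have "risk zero_one_loss P f \<le> (\<integral>\<^sup>+ z. 1 \<partial>P)"
    unfolding risk_def by (intro nn_integral_mono) (auto simp: zero_one_loss_def)
  then have finite: "risk zero_one_loss P f \<noteq> top"
    by (auto simp: emeasure_space_1 top_unique)
  have "risk zero_one_loss P f - ?D \<le> risk zero_one_loss P g" if g: "g \<in> predictors M" for g
  proof -
    note [measurable] = predictors_nth[OF f] predictors_nth[OF \<eta>] measurable_zero_one_loss[OF g]
    have "risk zero_one_loss P f \<le> (\<integral>\<^sup>+ x. (\<Sum>i\<in>UNIV. ennreal (\<eta> x $ i) * zero_one_loss (g x) i)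
        + ennreal (\<Sum>i\<in>UNIV. \<bar>\<eta> x $ i - f x $ i\<bar>) \<partial>\<mu>)"
      unfolding risk_conditional[OF measurable_zero_one_loss[OF f]]
      using predictors_simplex[OF \<eta>] by (intro nn_integral_mono sum_zero_one_loss_excess) (simp add: space_\<mu>)
    also have "\<dots> = risk zero_one_loss P g + ?D"
      unfolding risk_conditional[OF measurable_zero_one_loss[OF g]]
      by (rule nn_integral_add) (simp_all add: borel_measurable_\<mu>)
    finally show ?thesis using finite by (simp add: ennreal_minus_le_iff add.commute)
  qed
  then have "risk zero_one_loss P f - ?D \<le> bayes_risk M zero_one_loss P"
    unfolding bayes_risk_def by (intro INF_greatest)
  then show ?thesis
    using finite unfolding excess_risk_def by (simp add: ennreal_minus_le_iff add.commute)
qed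

text \<open>\<open>\<eta>\<close> is itself a predictor, so the Bayes risk is at most its risk, and
  the excess over \<open>\<eta>\<close> bounds the true excess from below. Pointwise,
  \<open>sum_log_loss_excess\<close> applies to \<open>T *v \<eta> x\<close> and
  \<open>T *v f x\<close>, which \<open>T\<close> keeps in the simplex.\<close>

lemma excess_forward_log_ge:
  assumes f: "f \<in> predictors M"
  shows "(\<integral>\<^sup>+ x. ennreal ((\<Sum>i\<in>UNIV. \<bar>(T *v \<eta> x) $ i - (T *v f x) $ i\<bar>)\<^sup>2 / 2) \<partial>\<mu>)
           \<le> excess_risk M (forward_loss T log_loss) (noisy M P T) f" (is "?K \<le> _")
proof -
  let ?R = "risk (forward_loss T log_loss) (noisy M P T)"
  note [measurable] = predictors_matrix_mult_nth[OF f, of T] predictors_matrix_mult_nth[OF \<eta>, of T]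
    measurable_forward_log_loss[OF \<eta>, of T]
  have simplex: "T *v g x \<in> prob_simplex" if "g \<in> predictors M" "x \<in> space \<mu>" for g x
    using column_stochastic_simplex[OF T] predictors_simplex that by (metis space_\<mu>)
  have "?R \<eta> + ?K = (\<integral>\<^sup>+ x. (\<Sum>i\<in>UNIV. ennreal ((T *v \<eta> x) $ i) * forward_loss T log_loss (\<eta> x) i)
        + ennreal ((\<Sum>i\<in>UNIV. \<bar>(T *v \<eta> x) $ i - (T *v f x) $ i\<bar>)\<^sup>2 / 2) \<partial>\<mu>)"
    unfolding risk_noisy_conditional[of "forward_loss T log_loss", OF measurable_forward_log_loss[OF \<eta>]]
    by (rule nn_integral_add[symmetric]) (simp_all add: borel_measurable_\<mu>)
  also have "\<dots> \<le> ?R f"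
    unfolding risk_noisy_conditional[of "forward_loss T log_loss", OF measurable_forward_log_loss[OF f]]
    unfolding forward_loss_def
    by (intro nn_integral_mono sum_log_loss_excess simplex \<eta> f)
  finally have "?K \<le> ?R f - ?R \<eta>"
    by (intro ennreal_le_minus_iff[THEN iffD2]) (simp add: add.commute)
  also have "\<dots> \<le> excess_risk M (forward_loss T log_loss) (noisy M P T) f"
    unfolding excess_risk_def bayes_risk_def by (intro ennreal_minus_mono order_refl INF_lower \<eta>)
  finally show ?thesis .
qed

end

section \<open>Combination of the two bounds\<close>

lemma (in prob_space) power2_nn_integral_le:
  assumes "d \<in> borel_measurable M"
  shows "(\<integral>\<^sup>+ x. d x \<partial>M)\<^sup>2 \<le> (\<integral>\<^sup>+ x. (d x)\<^sup>2 \<partial>M)"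
  using Cauchy_Schwarz_nn_integral[OF assms, of "\<lambda>_. 1"] by (simp add: emeasure_space_1)

text \<open>The squared form of the theorem's inequality: it can be proved by integrals alone, with
  the root postponed.\<close>

lemma power2_excess_le:
  fixes M :: "'a measure" and T :: "real ^ 'n::{finite,linorder} ^ 'n::{finite,linorder}"
    and P :: "('a \<times> 'n::{finite,linorder}) measure"
  assumes "invertible T" "column_stochastic T" "f \<in> predictors M"
    and P: "prob_measure_on (feature_label_space M) P"
  shows "(excess_risk M zero_one_loss P f)\<^sup>2
    \<le> ennreal (2 * (matrix_norm1 (matrix_inv T))\<^sup>2) * excess_risk M (forward_loss T log_loss) (noisy M P T) f"
proof -
  define \<mu> where "\<mu> = distr P M fst"
  obtain \<eta> :: "'a \<Rightarrow> real ^ 'n::{finite,linorder}" where \<eta>: "\<eta> \<in> predictors M"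
    and disint: "\<forall>F. (\<forall>i. F i \<in> borel_measurable M) \<longrightarrow>
          (\<integral>\<^sup>+ z. F (snd z) (fst z) \<partial>P) = (\<integral>\<^sup>+ x. (\<Sum>i\<in>UNIV. ennreal (\<eta> x $ i) * F i x) \<partial>\<mu>)"
    unfolding \<mu>_def using conditional_distribution[OF P] by blast
  have sP [measurable_cong]: "sets P = sets (M \<Otimes>\<^sub>M count_space UNIV)"
    using P by (simp add: prob_measure_on_def feature_label_space_def)
  have sets_\<mu> [measurable_cong]: "sets \<mu> = sets M" by (simp add: \<mu>_def)
  interpret P: prob_space P using P by (simp add: prob_measure_on_def)
  interpret prob_space \<mu> unfolding \<mu>_def by (rule P.prob_space_distr) measurable
  note [measurable] = predictors_nth[OF \<eta>] predictors_nth[OF assms(3)]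
    predictors_matrix_mult_nth[OF \<eta>, of T] predictors_matrix_mult_nth[OF assms(3), of T]
  define a where "a = matrix_norm1 (matrix_inv T)"
  let ?d = "\<lambda>x. \<Sum>i\<in>UNIV. \<bar>\<eta> x $ i - f x $ i\<bar>"
  let ?k = "\<lambda>x. \<Sum>i\<in>UNIV. \<bar>(T *v \<eta> x) $ i - (T *v f x) $ i\<bar>"
  have "(excess_risk M zero_one_loss P f)\<^sup>2 \<le> (\<integral>\<^sup>+ x. ennreal (?d x) \<partial>\<mu>)\<^sup>2"
    by (intro power_mono excess_zero_one_le[OF assms(2) P \<eta> sets_\<mu> disint assms(3)]) auto
  also have "\<dots> \<le> (\<integral>\<^sup>+ x. (ennreal (?d x))\<^sup>2 \<partial>\<mu>)"
    by (rule power2_nn_integral_le) measurable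
  \<comment> \<open>The factor 2 compensates the 1/2 in the lower bound from Pinsker's
    inequality.\<close>
  also have "\<dots> \<le> (\<integral>\<^sup>+ x. ennreal (2 * a\<^sup>2) * ennreal ((?k x)\<^sup>2 / 2) \<partial>\<mu>)"
  proof (rule nn_integral_mono)
    fix x
    have "(?d x)\<^sup>2 \<le> (a * ?k x)\<^sup>2"
      unfolding a_def by (intro power_mono inverse_noise_bound assms sum_nonneg) auto
    then have "(?d x)\<^sup>2 \<le> 2 * a\<^sup>2 * ((?k x)\<^sup>2 / 2)" by (simp add: power_mult_distrib)
    then show "(ennreal (?d x))\<^sup>2 \<le> ennreal (2 * a\<^sup>2) * ennreal ((?k x)\<^sup>2 / 2)"
      by (simp add: ennreal_power ennreal_mult[symmetric] sum_nonneg)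
  qed
  also have "\<dots> = ennreal (2 * a\<^sup>2) * (\<integral>\<^sup>+ x. ennreal ((?k x)\<^sup>2 / 2) \<partial>\<mu>)"
    by (rule nn_integral_cmult) measurable
  also have "\<dots> \<le> ennreal (2 * a\<^sup>2) * excess_risk M (forward_loss T log_loss) (noisy M P T) f"
    by (intro mult_left_mono excess_forward_log_ge[OF assms(2) P \<eta> sets_\<mu> disint assms(3)]) auto
  finally show ?thesis unfolding a_def .
qed

section \<open>Inversion of \<open>theta_lower\<close> and the final root\<close>

text \<open>By injectivity it suffices to apply \<open>theta_lower T\<close> to the right side. At
  \<open>x = top\<close> the positive norm keeps the product infinite.\<close>

lemma inv_theta_lower:
  fixes T :: "real ^ 'n::finite ^ 'n"
  assumes "invertible T"
  shows "inv (theta_lower T) x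
    = ennreal (sqrt 2) * ennreal (matrix_norm1 (matrix_inv T)) * ennreal_sqrt x"
proof (rule inv_f_eq)
  show "inj (theta_lower T)" using bij_theta_lower[OF assms] by (rule bij_is_inj)
  define a where "a = matrix_norm1 (matrix_inv T)"
  have a: "0 < a" unfolding a_def by (rule matrix_norm1_inv_pos[OF assms])
  have half: "(1::ennreal) / 2 = ennreal (1 / 2)"
    using ennreal_divide_numeral[of 1 "num.Bit0 num.One"] by simp
  show "theta_lower T (ennreal (sqrt 2) * ennreal (matrix_norm1 (matrix_inv T)) * ennreal_sqrt x) = x"
  proof (cases x)
    case (real r)
    then show ?thesis using a
      by (simp add: theta_lower_def ennreal_sqrt_def a_def[symmetric] half ennreal_power divide_ennreal
          ennreal_mult[symmetric] power_mult_distrib del: ennreal_half)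
  next
    case top
    then show ?thesis using a
      by (simp add: theta_lower_def ennreal_sqrt_def a_def[symmetric] half ennreal_power
        ennreal_top_divide ennreal_mult_eq_top_iff power2_eq_square ennreal_mult_top)
  qed
qed

text \<open>If \<open>y\<close> is infinite, so is the right side, since \<open>a\<close> is
  positive. Otherwise \<open>x\<close> is finite as well, and the root is taken over the
  reals.\<close>

lemma le_ennreal_sqrtI:
  assumes "x\<^sup>2 \<le> ennreal (2 * a\<^sup>2) * y" "0 < a"
  shows "x \<le> ennreal (sqrt 2) * ennreal a * ennreal_sqrt y"
proof (cases y)
  case (real r)
  have "x\<^sup>2 < top"
    using le_less_trans[OF assms(1)] real by (simp add: ennreal_mult_less_top)
  then obtain s where s: "x = ennreal s" "0 \<le> s"
    by (cases x) (simp_all add: power_less_top_ennreal)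
  have "s\<^sup>2 \<le> (sqrt 2 * a * sqrt r)\<^sup>2"
    using assms real s by (simp add: ennreal_power ennreal_mult[symmetric] power_mult_distrib)
  then have "s \<le> sqrt 2 * a * sqrt r"
    by (rule power2_le_imp_le) (use assms(2) real in simp)
  then show ?thesis using assms(2) real s by (simp add: ennreal_sqrt_def ennreal_mult[symmetric])
next
  case top
  then show ?thesis using assms(2) by (simp add: ennreal_sqrt_def ennreal_mult_top ennreal_mult_eq_top_iff)
qed

theorem proposition6:
  fixes M :: "'a measure"
    and T :: "real ^ 'n::{finite,linorder} ^ 'n::{finite,linorder}"
    and f :: "'a \<Rightarrow> real ^ 'n::{finite,linorder}"
    and P :: "('a \<times> 'n::{finite,linorder}) measure"
  assumes "invertible T"
    and "column_stochastic T"
    and "f \<in> predictors M"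
    and "prob_measure_on (feature_label_space M) P"
  shows "excess_risk M zero_one_loss P f
           \<le> inv (theta_lower T) (excess_risk M (forward_loss T log_loss) (noisy M P T) f)
       \<and> inv (theta_lower T) (excess_risk M (forward_loss T log_loss) (noisy M P T) f)
           = ennreal (sqrt 2) * ennreal (matrix_norm1 (matrix_inv T))
             * ennreal_sqrt (excess_risk M (forward_loss T log_loss) (noisy M P T) f)"
  \<comment> \<open>The closed form of the inverse settles the equation and leaves the root of the
    squared bound.\<close>
  unfolding inv_theta_lower[OF assms(1)]
  using le_ennreal_sqrtI[OF power2_excess_le[OF assms] matrix_norm1_inv_pos[OF assms(1)]] by simp

end
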